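(* The variety $\mathbf{V}(\mathrm{Rel}^i(\cdot,\circ,0,1))$ generated by the class of integral relation algebras of similarity type $(\cdot,\circ,0,1)$ is axiomatized by the set of equations $\mathrm{Ax}^i(\cdot,\circ,0,1)$. That is, an equation in the signature $(\cdot,\circ,0,1)$ is valid in every integral relation algebra of this signature if and only if it is derivable in equational logic from $\mathrm{Ax}^i(\cdot,\circ,0,1)$.
   Context: An algebra $\mathfrak{A}=(A,\cdot,\circ,0,1)$ is a relation algebra (of this signature) if there is a set $U$ with $A\subseteq\wp(U\times U)$, where $\cdot$ is intersection, $\circ$ is relational composition $a\circ b=\{(u,v): \exists w\,((u,w)\in a,(w,v)\in b)\}$, $1$ is the identity relation on $U$ and $0$ is the empty relation. Such an algebra is integral if $1$ is an atom, i.e. a minimal nonzero element of $A$. $\mathrm{Rel}^i(\cdot,\circ,0,1)$ is the class of integral relation algebras of this signature, and $\mathbf{V}(K)$ denotes the variety generated by a class $K$. Conventions: $x\le y$ abbreviates $x\cdot y=x$; $\circ$ binds tighter than $\cdot$. $\mathrm{Ax}(\cdot,\circ,0,1)$ consists of: the semilattice axioms for $\cdot$; the monoid axioms for $\circ$ and $1$; monotonicity $(x\cdot x')\circ(y\cdot y')\le x\circ y$; $0=0\cdot x$; $0=0\circ x=x\circ 0$; $(1\cdot x)\circ(1\cdot y)=1\cdot x\cdot y$; $(1\cdot x)\circ(y\cdot z)=((1\cdot x)\circ y)\cdot z$; $(x\cdot y)\circ(1\cdot z)=x\cdot (y\circ(1\cdot z))$. $\mathrm{Ax}^i(\cdot,\circ,0,1)$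 is $\mathrm{Ax}(\cdot,\circ,0,1)$ together with the two equations $1\cdot(x\circ y)=1\cdot(y\circ x)$ and $(1\cdot x)\circ y=y\circ(1\cdot x)$. *)

theory Defs
  imports Main
begin

datatype trm =
    Var nat
  | Meet trm trm  (infixl "\<sqdot>" 70)
  | Comp trm trm  (infixl "\<odot>" 75)
  | Zero  ("\<zero>")
  | One  ("\<one>")

type_synonym equation = "trm \<times> trm"

fun subst :: "(nat \<Rightarrow> trm) \<Rightarrow> trm \<Rightarrow> trm" where
  "subst \<sigma> (Var n) = \<sigma> n"
| "subst \<sigma> (s \<sqdot> t) = subst \<sigma> s \<sqdot> subst \<sigma> t"
| "subst \<sigma> (s \<odot> t) = subst \<sigma> s \<odot> subst \<sigma> t"
| "subst \<sigma> \<zero> = \<zero>"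
| "subst \<sigma> \<one> = \<one>"

inductive derivable :: "equation set \<Rightarrow> trm \<Rightarrow> trm \<Rightarrow> bool" for E where
  axiom: "(s, t) \<in> E \<Longrightarrow> derivable E s t"
| refl: "derivable E s s"
| sym: "derivable E s t \<Longrightarrow> derivable E t s"
| trans: "derivable E s t \<Longrightarrow> derivable E t u \<Longrightarrow> derivable E s u"
| cong_meet: "derivable E s s' \<Longrightarrow> derivable E t t' \<Longrightarrow> derivable E (s \<sqdot> t) (s' \<sqdot> t')"
| cong_comp: "derivable E s s' \<Longrightarrow> derivable E t t' \<Longrightarrow> derivable E (s \<odot> t) (s' \<odot> t')"
| subst: "derivable E s t \<Longrightarrow> derivable E (subst \<sigma> s) (subst \<sigma> t)"

record 'a alg =
  carrier :: "'a set"
  meet :: "'a \<Rightarrow> 'a \<Rightarrow> 'a"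
  comp :: "'a \<Rightarrow> 'a \<Rightarrow> 'a"
  zero :: 'a
  one :: 'a

definition is_alg :: "'a alg \<Rightarrow> bool" where
  "is_alg \<AA> \<longleftrightarrow>
     (\<forall>a\<in>carrier \<AA>. \<forall>b\<in>carrier \<AA>. meet \<AA> a b \<in> carrier \<AA>) \<and>
     (\<forall>a\<in>carrier \<AA>. \<forall>b\<in>carrier \<AA>. comp \<AA> a b \<in> carrier \<AA>) \<and>
     zero \<AA> \<in> carrier \<AA> \<and> one \<AA> \<in> carrier \<AA>"

fun eval :: "'a alg \<Rightarrow> (nat \<Rightarrow> 'a) \<Rightarrow> trm \<Rightarrow> 'a" where
  "eval \<AA> v (Var n) = v n"
| "eval \<AA> v (s \<sqdot> t) = meet \<AA> (eval \<AA> v s) (eval \<AA> v t)"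
| "eval \<AA> v (s \<odot> t) = comp \<AA> (eval \<AA> v s) (eval \<AA> v t)"
| "eval \<AA> v \<zero> = zero \<AA>"
| "eval \<AA> v \<one> = one \<AA>"

definition satisfies :: "'a alg \<Rightarrow> equation \<Rightarrow> bool" where
  "satisfies \<AA> e \<longleftrightarrow>
     (\<forall>v. range v \<subseteq> carrier \<AA> \<longrightarrow> eval \<AA> v (fst e) = eval \<AA> v (snd e))"

definition models :: "equation set \<Rightarrow> 'a alg set" where
  "models E = {\<AA>. is_alg \<AA> \<and> (\<forall>e\<in>E. satisfies \<AA> e)}"

text \<open>A variety is an equationally definable class, and the variety generated by a class is
  the least one containing it. Equations link the two sides, so the members of the generated
  variety may live on a different type than the generating algebras.\<close>

definition variety_generated :: "'b alg set \<Rightarrow> 'a alg set" where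
  "variety_generated K = (\<Inter>E \<in> {E. K \<subseteq> models E}. models E)"

definition relation_algebra :: "('u \<times> 'u) set alg \<Rightarrow> bool" where
  "relation_algebra \<AA> \<longleftrightarrow> is_alg \<AA> \<and>
     (\<exists>U. carrier \<AA> \<subseteq> Pow (U \<times> U) \<and>
       (\<forall>a\<in>carrier \<AA>. \<forall>b\<in>carrier \<AA>. meet \<AA> a b = a \<inter> b) \<and>
       (\<forall>a\<in>carrier \<AA>. \<forall>b\<in>carrier \<AA>. comp \<AA> a b = a O b) \<and>
       zero \<AA> = {} \<and> one \<AA> = Id_on U)"

definition integral :: "'a alg \<Rightarrow> bool" where
  "integral \<AA> \<longleftrightarrow> one \<AA> \<noteq> zero \<AA> \<and>
     (\<forall>a\<in>carrier \<AA>. a \<noteq> zero \<AA> \<longrightarrow> meet \<AA> a (one \<AA>) = a \<longrightarrow> a = one \<AA>)"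

definition Rel_i :: "('u \<times> 'u) set alg set" where
  "Rel_i = {\<AA>. relation_algebra \<AA> \<and> integral \<AA>}"

definition le_eqn :: "trm \<Rightarrow> trm \<Rightarrow> equation" where
  "le_eqn s t = (s \<sqdot> t, s)"

definition Ax :: "equation set" where
  "Ax = (let x = Var 0; y = Var 1; z = Var 2; x' = Var 3; y' = Var 4 in
    {(x \<sqdot> (y \<sqdot> z), (x \<sqdot> y) \<sqdot> z),
     (x \<sqdot> y, y \<sqdot> x),
     (x \<sqdot> x, x),
     (x \<odot> (y \<odot> z), (x \<odot> y) \<odot> z),
     (\<one> \<odot> x, x),
     (x \<odot> \<one>, x),
     le_eqn ((x \<sqdot> x') \<odot> (y \<sqdot> y')) (x \<odot> y),
     (\<zero>, \<zero> \<sqdot> x),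
     (\<zero>, \<zero> \<odot> x),
     (\<zero>, x \<odot> \<zero>),
     ((\<one> \<sqdot> x) \<odot> (\<one> \<sqdot> y), \<one> \<sqdot> x \<sqdot> y),
     ((\<one> \<sqdot> x) \<odot> (y \<sqdot> z), ((\<one> \<sqdot> x) \<odot> y) \<sqdot> z),
     ((x \<sqdot> y) \<odot> (\<one> \<sqdot> z), x \<sqdot> (y \<odot> (\<one> \<sqdot> z)))})"

definition Ax_i :: "equation set" where
  "Ax_i = (let x = Var 0; y = Var 1 in Ax \<union>
    {(\<one> \<sqdot> (x \<odot> y), \<one> \<sqdot> (y \<odot> x)),
     ((\<one> \<sqdot> x) \<odot> y, y \<odot> (\<one> \<sqdot> x))})"

end

theory Submission
  imports Defs "HOL-Library.Countable"
begin

text \<open>For completeness, suppose \<open>s \<le> t\<close> is not derivable. Identify with \<open>\<one>\<close> every subidentity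
  \<open>\<one> \<sqdot> r\<close> that fixes \<open>s\<close>; this does not make \<open>s \<le> t\<close> provable, and afterwards only \<open>\<one>\<close> fixes
  \<open>s\<close>. Starting from a single edge labelled \<open>s\<close>, build a labelled directed graph step by step,
  adding a new point between the ends of an edge whose label lies below a composition. Labels
  of new edges are composed along paths; they inherit from existing labels the property of being
  fixed by no subidentity but \<open>\<one>\<close>, and so are nonzero and, off the diagonal, not below \<open>\<one>\<close>.
  The rotation law \<open>\<one> \<sqdot> (x \<odot> y) = \<one> \<sqdot> (y \<odot> x)\<close> ensures that a cycle through a new point
  composes to something above \<open>\<one>\<close>. Hence all loops carry the label \<open>\<one>\<close>, so that a term holding
  at one loop holds at all of them: the relations read off the limit form an integral relation
  algebra refuting \<open>s \<le> t\<close>.\<close>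

section \<open>Soundness\<close>

lemma eval_in_carrier:
  assumes "is_alg \<AA>" "range v \<subseteq> carrier \<AA>"
  shows "eval \<AA> v t \<in> carrier \<AA>"
  using assms by (induction t) (auto simp: is_alg_def)

lemma eval_subst: "eval \<AA> v (subst \<sigma> t) = eval \<AA> (\<lambda>n. eval \<AA> v (\<sigma> n)) t"
  by (induction t) auto

lemma derivable_sound:
  assumes "derivable E s t" "\<AA> \<in> models E"
  shows "satisfies \<AA> (s, t)"
  using assms(1)
proof (induction rule: derivable.induct)
  case (axiom s t)
  then show ?case using assms(2) by (auto simp: models_def)
next
  case (subst s t \<sigma>)
  have alg: "is_alg \<AA>" using assms(2) by (simp add: models_def)
  show ?case
    unfolding satisfies_def
  proof (intro allI impI)
    fix v :: "nat \<Rightarrow> _" assume "range v \<subseteq> carrier \<AA>"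
    then have "range (\<lambda>n. eval \<AA> v (\<sigma> n)) \<subseteq> carrier \<AA>"
      using eval_in_carrier[OF alg] by blast
    then show "eval \<AA> v (fst (subst \<sigma> s, subst \<sigma> t)) = eval \<AA> v (snd (subst \<sigma> s, subst \<sigma> t))"
      using subst.IH by (simp add: satisfies_def eval_subst)
  qed
qed (auto simp: satisfies_def)

lemma models_eqns:
  "\<AA> \<in> models E \<longleftrightarrow> is_alg \<AA> \<and>
     (\<forall>(s, t) \<in> E. \<forall>v. range v \<subseteq> carrier \<AA> \<longrightarrow> eval \<AA> v s = eval \<AA> v t)"
  by (auto simp: models_def satisfies_def)

text \<open>By atomicity every element meets the identity in \<open>{}\<close> or in all of
  \<open>Id_on U\<close>. The two equations beyond \<open>Ax\<close> rest on this; those of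
  \<open>Ax\<close> hold in all relation algebras.\<close>

lemma Rel_i_sound: "Rel_i \<subseteq> models Ax_i"
proof
  fix \<AA> :: "('u \<times> 'u) set alg" assume "\<AA> \<in> Rel_i"
  then have alg: "is_alg \<AA>" and int: "integral \<AA>" and rel: "relation_algebra \<AA>"
    by (auto simp: Rel_i_def relation_algebra_def)
  from rel obtain U where sub: "carrier \<AA> \<subseteq> Pow (U \<times> U)"
    and m: "\<And>a b. a \<in> carrier \<AA> \<Longrightarrow> b \<in> carrier \<AA> \<Longrightarrow> meet \<AA> a b = a \<inter> b"
    and c: "\<And>a b. a \<in> carrier \<AA> \<Longrightarrow> b \<in> carrier \<AA> \<Longrightarrow> comp \<AA> a b = a O b"
    and z: "zero \<AA> = {}" and o: "one \<AA> = Id_on U"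
    unfolding relation_algebra_def by auto
  have oc: "Id_on U \<in> carrier \<AA>" and zc: "{} \<in> carrier \<AA>"
    and mc: "\<And>a b. a \<in> carrier \<AA> \<Longrightarrow> b \<in> carrier \<AA> \<Longrightarrow> a \<inter> b \<in> carrier \<AA>"
    and cc: "\<And>a b. a \<in> carrier \<AA> \<Longrightarrow> b \<in> carrier \<AA> \<Longrightarrow> a O b \<in> carrier \<AA>"
    using alg m c z o unfolding is_alg_def by auto
  have atom: "Id_on U \<inter> a = {} \<or> Id_on U \<inter> a = Id_on U" if "a \<in> carrier \<AA>" for a
  proof -
    have "meet \<AA> (Id_on U \<inter> a) (Id_on U) = Id_on U \<inter> a"
      using m[OF mc[OF oc that] oc] by auto
    then show ?thesis
      using int mc[OF oc that] unfolding integral_def z o by blast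
  qed
  have unit: "Id_on U O a = a" "a O Id_on U = a" if "a \<in> carrier \<AA>" for a
    using sub that by auto
  \<comment> \<open>A diagonal pair of \<open>p O q\<close> through an intermediate point
    \<open>y\<close> gives the pair \<open>(y, y)\<close> in \<open>q O p\<close>; by atomicity the
    whole identity then lies in \<open>q O p\<close>.\<close>
  have rot_le: "Id_on U \<inter> p O q \<subseteq> q O p" if "p \<in> carrier \<AA>" "q \<in> carrier \<AA>" for p q
  proof (cases "Id_on U \<inter> p O q = {}")
    case False
    then obtain x y where "(x, y) \<in> p" "(y, x) \<in> q" by auto
    moreover have "y \<in> U" using sub that(2) \<open>(y, x) \<in> q\<close> by auto
    ultimately have "Id_on U \<inter> q O p \<noteq> {}" by auto
    then have "Id_on U \<subseteq> q O p" using atom[OF cc[OF that(2,1)]] by blast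
    then show ?thesis by blast
  qed blast
  have rot: "Id_on U \<inter> a O b = Id_on U \<inter> b O a" if "a \<in> carrier \<AA>" "b \<in> carrier \<AA>" for a b
    using rot_le[OF that] rot_le[OF that(2,1)] by blast
  have com: "(Id_on U \<inter> a) O b = b O (Id_on U \<inter> a)"
    if "a \<in> carrier \<AA>" "b \<in> carrier \<AA>" for a b
    using atom[OF that(1)] unit[OF that(2)] by auto
  show "\<AA> \<in> models Ax_i"
    unfolding models_eqns
  proof (intro conjI ballI alg, clarify)
    fix s t and v :: "nat \<Rightarrow> _" assume st: "(s, t) \<in> Ax_i" and "range v \<subseteq> carrier \<AA>"
    then have v: "v n \<in> carrier \<AA>" for n by blast
    note sims = m c z o oc zc mc cc v
    from st show "eval \<AA> v s = eval \<AA> v t"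
      unfolding Ax_i_def Ax_def Let_def le_eqn_def
      apply (elim UnE insertE emptyE; clarsimp simp: sims unit)
      apply ((rule rot com; rule v) | (auto; fail))+
      done
  qed
qed

text \<open>This model serves to show that a nonzero composite lies provably below one only if both
  factors do.\<close>

definition chain_alg :: "nat alg" where
  "chain_alg = \<lparr>carrier = UNIV, meet = min,
     comp = (\<lambda>a b. if a = 0 \<or> b = 0 then 0 else max a b), zero = 0, one = 1\<rparr>"

lemma chain_alg_model: "chain_alg \<in> models Ax_i"
  unfolding models_eqns
  by (auto simp: chain_alg_def is_alg_def Ax_i_def Ax_def Let_def le_eqn_def min_def max_def)

section \<open>The provable order\<close>

text \<open>The laws are stated for an arbitrary preorder on terms because they are used twice: for
  \<open>prov_le\<close>, and for its extension \<open>le_mod s\<close> below.\<close>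

locale term_order =
  fixes le :: "trm \<Rightarrow> trm \<Rightarrow> bool"  (infix "\<preceq>" 50)
  assumes ord_refl: "x \<preceq> x"
    and ord_trans [trans]: "x \<preceq> y \<Longrightarrow> y \<preceq> z \<Longrightarrow> x \<preceq> z"
    and meet_lower1: "x \<sqdot> y \<preceq> x"
    and meet_lower2: "x \<sqdot> y \<preceq> y"
    and meet_greatest: "z \<preceq> x \<Longrightarrow> z \<preceq> y \<Longrightarrow> z \<preceq> x \<sqdot> y"
    and comp_mono: "x \<preceq> x' \<Longrightarrow> y \<preceq> y' \<Longrightarrow> x \<odot> y \<preceq> x' \<odot> y'"
    and assoc1: "x \<odot> (y \<odot> z) \<preceq> (x \<odot> y) \<odot> z"
    and assoc2: "(x \<odot> y) \<odot> z \<preceq> x \<odot> (y \<odot> z)"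
    and one_left1: "\<one> \<odot> x \<preceq> x"
    and one_left2: "x \<preceq> \<one> \<odot> x"
    and one_right1: "x \<odot> \<one> \<preceq> x"
    and one_right2: "x \<preceq> x \<odot> \<one>"
    and zero_least: "\<zero> \<preceq> x"
    and sub_meet: "\<one> \<sqdot> x \<sqdot> y \<preceq> (\<one> \<sqdot> x) \<odot> (\<one> \<sqdot> y)"
    and sub_comp_meet: "((\<one> \<sqdot> x) \<odot> y) \<sqdot> z \<preceq> (\<one> \<sqdot> x) \<odot> (y \<sqdot> z)"
    and rotate: "\<one> \<sqdot> (x \<odot> y) \<preceq> y \<odot> x"
    and sub_commute1: "(\<one> \<sqdot> x) \<odot> y \<preceq> y \<odot> (\<one> \<sqdot> x)"
    and sub_commute2: "y \<odot> (\<one> \<sqdot> x) \<preceq> (\<one> \<sqdot> x) \<odot> y"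

section \<open>Provable inequality as an instance of the abstract order\<close>

abbreviation prov_le :: "trm \<Rightarrow> trm \<Rightarrow> bool" where
  "prov_le s t \<equiv> derivable Ax_i (s \<sqdot> t) s"

definition inst :: "trm list \<Rightarrow> nat \<Rightarrow> trm" where
  "inst ts n = (if n < length ts then ts ! n else \<zero>)"

lemma Ax_i_instances:
  shows "derivable Ax_i (a \<sqdot> (b \<sqdot> c)) ((a \<sqdot> b) \<sqdot> c)" (is ?thesis1)
    and "derivable Ax_i (a \<sqdot> b) (b \<sqdot> a)" (is ?thesis2)
    and "derivable Ax_i (a \<sqdot> a) a" (is ?thesis3)
    and "derivable Ax_i (a \<odot> (b \<odot> c)) ((a \<odot> b) \<odot> c)" (is ?thesis4)
    and "derivable Ax_i (\<one> \<odot> a) a" (is ?thesis5)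
    and "derivable Ax_i (a \<odot> \<one>) a" (is ?thesis6)
    and "prov_le ((a \<sqdot> d) \<odot> (b \<sqdot> e)) (a \<odot> b)" (is ?thesis7)
    and "derivable Ax_i \<zero> (\<zero> \<sqdot> a)" (is ?thesis8)
    and "derivable Ax_i \<zero> (\<zero> \<odot> a)" (is ?thesis9)
    and "derivable Ax_i \<zero> (a \<odot> \<zero>)" (is ?thesis10)
    and "derivable Ax_i ((\<one> \<sqdot> a) \<odot> (\<one> \<sqdot> b)) (\<one> \<sqdot> a \<sqdot> b)" (is ?thesis11)
    and "derivable Ax_i ((\<one> \<sqdot> a) \<odot> (b \<sqdot> c)) (((\<one> \<sqdot> a) \<odot> b) \<sqdot> c)" (is ?thesis12)
    and "derivable Ax_i (\<one> \<sqdot> (a \<odot> b)) (\<one> \<sqdot> (b \<odot> a))" (is ?thesis13)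
    and "derivable Ax_i ((\<one> \<sqdot> a) \<odot> b) (b \<odot> (\<one> \<sqdot> a))" (is ?thesis14)
proof -
  \<comment> \<open>One substitution serves all axioms; \<open>d\<close> and \<open>e\<close>
    replace \<open>Var 3\<close> and \<open>Var 4\<close>, the x' and y' of the monotonicity
    axiom.\<close>
  have "derivable Ax_i (subst (inst [a, b, c, d, e]) s) (subst (inst [a, b, c, d, e]) t)"
    if "(s, t) \<in> Ax_i" for s t
    using that by (intro derivable.subst derivable.axiom)
  then have "\<forall>(s, t) \<in> Ax_i. derivable Ax_i (subst (inst [a, b, c, d, e]) s) (subst (inst [a, b, c, d, e]) t)"
    by blast
  then show ?thesis1 ?thesis2 ?thesis3 ?thesis4 ?thesis5 ?thesis6 ?thesis7 ?thesis8 ?thesis9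
    ?thesis10 ?thesis11 ?thesis12 ?thesis13 ?thesis14
    unfolding Ax_i_def Ax_def Let_def le_eqn_def by (simp_all add: inst_def)
qed

context begin
private lemmas ax = Ax_i_instances
private lemmas dtrans = derivable.trans and dsym = derivable.sym
private lemmas drefl = derivable.refl

lemma prov_leI: "derivable Ax_i s t \<Longrightarrow> prov_le s t"
  by (meson ax(3) derivable.cong_meet drefl dsym dtrans)

lemma prov_le_antisym: "prov_le s t \<Longrightarrow> prov_le t s \<Longrightarrow> derivable Ax_i s t"
  by (meson ax(2) dsym dtrans)

lemma prov_le_trans:
  assumes "prov_le x y" "prov_le y z"
  shows "prov_le x z"
proof -
  have "derivable Ax_i (x \<sqdot> z) ((x \<sqdot> y) \<sqdot> z)"
    using assms(1) by (intro derivable.cong_meet drefl) (rule dsym)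
  moreover have "derivable Ax_i ((x \<sqdot> y) \<sqdot> z) (x \<sqdot> (y \<sqdot> z))"
    by (rule dsym[OF ax(1)])
  moreover have "derivable Ax_i (x \<sqdot> (y \<sqdot> z)) (x \<sqdot> y)"
    using assms(2) by (intro derivable.cong_meet drefl)
  ultimately show ?thesis using assms(1) by (blast intro: dtrans)
qed

lemma prov_le_meet1: "prov_le (x \<sqdot> y) x"
  by (meson ax(1,2,3) derivable.cong_meet drefl dsym dtrans)

lemma prov_le_meet2: "prov_le (x \<sqdot> y) y"
  by (meson prov_le_trans[OF prov_leI[OF ax(2)] prov_le_meet1])

lemma prov_le_meet_greatest: "prov_le z x \<Longrightarrow> prov_le z y \<Longrightarrow> prov_le z (x \<sqdot> y)"
  by (meson ax(1) derivable.cong_meet drefl dtrans)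

text \<open>The monotonicity axiom speaks of products of meets, so \<open>x\<close> and
  \<open>y\<close> are first rewritten as \<open>x' \<sqdot> x\<close> and
  \<open>y' \<sqdot> y\<close>.\<close>

lemma prov_le_comp_mono:
  assumes "prov_le x x'" "prov_le y y'"
  shows "prov_le (x \<odot> y) (x' \<odot> y')"
proof -
  have "derivable Ax_i (x' \<sqdot> x) x" "derivable Ax_i (y' \<sqdot> y) y"
    using assms ax(2) dtrans by blast+
  then have "prov_le (x \<odot> y) ((x' \<sqdot> x) \<odot> (y' \<sqdot> y))"
    by (meson prov_leI derivable.cong_comp dsym)
  then show ?thesis using ax(7) prov_le_trans by blast
qed

lemma term_order_prov_le: "term_order prov_le"
proof
  show "prov_le (\<one> \<sqdot> (x \<odot> y)) (y \<odot> x)" for x y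
    using prov_leI[OF ax(13)] prov_le_meet2 by (rule prov_le_trans)
  show "prov_le \<zero> x" for x
    by (rule dsym[OF ax(8)])
qed (rule ax(3) prov_le_meet1 prov_le_meet2 ax(4,5,6,11,12,14)[THEN prov_leI]
      ax(4,5,6,11,12,14)[THEN dsym, THEN prov_leI] |
      erule (1) prov_le_trans prov_le_meet_greatest prov_le_comp_mono)+


text \<open>Converse to soundness for the bounds \<open>\<zero>\<close> and \<open>\<one>\<close>. A
  minimum is attained by one of its arguments; a composite of value 0 has a factor of value 0, and
  one of value 1 has both factors of value 1. Variables get the value 2 so as to lie below neither
  bound.\<close>

lemma chain_alg_eval:
  shows "eval chain_alg (\<lambda>_. 2) t = 0 \<Longrightarrow> prov_le t \<zero>"
    and "eval chain_alg (\<lambda>_. 2) t = 1 \<Longrightarrow> prov_le t \<one>"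
proof (induction t)
  case (Meet t u)
  { case 1
    then have "prov_le t \<zero> \<or> prov_le u \<zero>" using Meet.IH(1,3) by (auto simp: chain_alg_def min_def split: if_splits)
    then show ?case using prov_le_meet1 prov_le_meet2 prov_le_trans by blast
  next
    case 2
    then have "prov_le t \<one> \<or> prov_le u \<one>" using Meet.IH(2,4) by (auto simp: chain_alg_def min_def split: if_splits)
    then show ?case using prov_le_meet1 prov_le_meet2 prov_le_trans by blast }
next
  case (Comp t u)
  { case 1
    then consider "prov_le t \<zero>" | "prov_le u \<zero>"
      using Comp.IH(1,3) by (auto simp: chain_alg_def split: if_splits)
    then show ?case
    proof cases
      case 1
      show ?thesis
        by (rule prov_le_trans[OF prov_le_comp_mono[OF 1 ax(3)] prov_leI[OF dsym[OF ax(9)]]])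
    next
      case 2
      show ?thesis
        by (rule prov_le_trans[OF prov_le_comp_mono[OF ax(3) 2] prov_leI[OF dsym[OF ax(10)]]])
    qed
  next
    case 2
    then have "prov_le t \<one>" "prov_le u \<one>"
      using Comp.IH(2,4) by (auto simp: chain_alg_def max_def split: if_splits)
    then show ?case by (rule prov_le_trans[OF prov_le_comp_mono prov_leI[OF ax(5)]]) }
qed (auto simp: chain_alg_def intro: drefl ax(3))

end

context term_order
begin

section \<open>Elementary laws of subidentities\<close>

lemma sub_le: "\<one> \<sqdot> x \<preceq> \<one>" "\<one> \<sqdot> x \<preceq> x"
  by (rule meet_lower1 meet_lower2)+

lemma sub_mono: "x \<preceq> y \<Longrightarrow> \<one> \<sqdot> x \<preceq> \<one> \<sqdot> y"
  by (rule meet_greatest[OF sub_le(1) ord_trans[OF sub_le(2)]])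

lemma sub_idem: "\<one> \<sqdot> x \<preceq> (\<one> \<sqdot> x) \<odot> (\<one> \<sqdot> x)"
  by (rule ord_trans[OF meet_greatest[OF ord_refl sub_le(2)] sub_meet])

lemma comp_mono_left: "x \<preceq> y \<Longrightarrow> x \<odot> z \<preceq> y \<odot> z"
  by (rule comp_mono[OF _ ord_refl])

lemma comp_mono_right: "x \<preceq> y \<Longrightarrow> z \<odot> x \<preceq> z \<odot> y"
  by (rule comp_mono[OF ord_refl])

lemma sub_left: "(\<one> \<sqdot> r) \<odot> x \<preceq> x"
  by (rule ord_trans[OF comp_mono_left[OF sub_le(1)] one_left1])

text \<open>A subidentity is idempotent and commutes with everything, so it can be copied to both
  factors. This makes composition monotone for \<open>le_mod\<close>.\<close>

lemma sub_comp_dup: "(\<one> \<sqdot> r) \<odot> (x \<odot> y) \<preceq> ((\<one> \<sqdot> r) \<odot> x) \<odot> ((\<one> \<sqdot> r) \<odot> y)"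
proof -
  let ?e = "\<one> \<sqdot> r"
  have "?e \<odot> (x \<odot> y) \<preceq> (?e \<odot> x) \<odot> y" by (rule assoc1)
  also have "\<dots> \<preceq> ((?e \<odot> ?e) \<odot> x) \<odot> y" by (intro comp_mono_left sub_idem)
  also have "\<dots> \<preceq> (?e \<odot> (?e \<odot> x)) \<odot> y" by (intro comp_mono_left assoc2)
  also have "\<dots> \<preceq> ((?e \<odot> x) \<odot> ?e) \<odot> y" by (intro comp_mono_left sub_commute1)
  also have "\<dots> \<preceq> (?e \<odot> x) \<odot> (?e \<odot> y)" by (rule assoc2)
  finally show ?thesis .
qed

text \<open>Subidentities that fix \<open>s\<close> hold at one point of a representation of \<open>s\<close>, hence
  at every point if the representation is integral; so they may be identified with one.\<close>

definition fixing :: "trm \<Rightarrow> trm \<Rightarrow> bool" where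
  "fixing s r \<longleftrightarrow> s \<preceq> (\<one> \<sqdot> r) \<odot> s"

text \<open>The least order of this kind that extends \<open>\<preceq>\<close> and puts
  \<open>\<one>\<close> below every \<open>r\<close> fixing \<open>s\<close>.\<close>

definition le_mod :: "trm \<Rightarrow> trm \<Rightarrow> trm \<Rightarrow> bool" where
  "le_mod s x y \<longleftrightarrow> (\<exists>r. fixing s r \<and> (\<one> \<sqdot> r) \<odot> x \<preceq> y)"

text \<open>Apply the two subidentities one after the other; their product lies below their meet.
  Hence two inequalities modulo \<open>s\<close> can share a single \<open>r\<close>.\<close>

lemma fixing_meet:
  assumes "fixing s r" "fixing s r'"
  shows "fixing s (r \<sqdot> r')"
proof -
  have "s \<preceq> (\<one> \<sqdot> r) \<odot> s" using assms(1) by (simp add: fixing_def)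
  also have "\<dots> \<preceq> (\<one> \<sqdot> r) \<odot> ((\<one> \<sqdot> r') \<odot> s)"
    using assms(2) unfolding fixing_def by (rule comp_mono_right)
  also have "\<dots> \<preceq> ((\<one> \<sqdot> r) \<odot> (\<one> \<sqdot> r')) \<odot> s" by (rule assoc1)
  also have "\<dots> \<preceq> (\<one> \<sqdot> (r \<sqdot> r')) \<odot> s"
  proof (intro comp_mono_left meet_greatest)
    have l: "(\<one> \<sqdot> r) \<odot> (\<one> \<sqdot> r') \<preceq> \<one> \<sqdot> r"
      by (rule ord_trans[OF comp_mono_right[OF sub_le(1)] one_right1])
    show "(\<one> \<sqdot> r) \<odot> (\<one> \<sqdot> r') \<preceq> \<one>" "(\<one> \<sqdot> r) \<odot> (\<one> \<sqdot> r') \<preceq> r"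
      using ord_trans[OF l] sub_le by blast+
    show "(\<one> \<sqdot> r) \<odot> (\<one> \<sqdot> r') \<preceq> r'"
      by (rule ord_trans[OF sub_left sub_le(2)])
  qed
  finally show ?thesis by (simp add: fixing_def)
qed

lemma le_modI: "x \<preceq> y \<Longrightarrow> le_mod s x y"
  unfolding le_mod_def fixing_def
  \<comment> \<open>\<open>\<one>\<close> fixes every term because
    \<open>\<one> \<preceq> \<one> \<sqdot> \<one>\<close>.\<close>
  by (rule exI[of _ \<one>]) (meson comp_mono meet_greatest one_left2 ord_refl ord_trans sub_left)

lemma le_mod_common:
  assumes "le_mod s x y" "le_mod s x' y'"
  obtains r where "fixing s r" "(\<one> \<sqdot> r) \<odot> x \<preceq> y" "(\<one> \<sqdot> r) \<odot> x' \<preceq> y'"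
proof -
  obtain r r' where r: "fixing s r" "(\<one> \<sqdot> r) \<odot> x \<preceq> y" and r': "fixing s r'" "(\<one> \<sqdot> r') \<odot> x' \<preceq> y'"
    using assms unfolding le_mod_def by blast
  show ?thesis
    by (rule that[OF fixing_meet[OF r(1) r'(1)]])
      (use r(2) r'(2) in \<open>blast intro: ord_trans[OF comp_mono_left[OF sub_mono]] meet_lower1 meet_lower2\<close>)+
qed

text \<open>With a common \<open>r\<close> for both premises, transitivity follows from
  \<open>sub_idem\<close> and monotonicity of composition from \<open>sub_comp_dup\<close>. The laws
  without premises carry over from \<open>\<preceq>\<close>.\<close>

lemma term_order_le_mod: "term_order (le_mod s)"
proof
  fix x y z assume "le_mod s x y" "le_mod s y z"
  then obtain r where r: "fixing s r" "(\<one> \<sqdot> r) \<odot> x \<preceq> y" "(\<one> \<sqdot> r) \<odot> y \<preceq> z"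
    by (rule le_mod_common)
  have "(\<one> \<sqdot> r) \<odot> x \<preceq> ((\<one> \<sqdot> r) \<odot> (\<one> \<sqdot> r)) \<odot> x" by (intro comp_mono_left sub_idem)
  also have "\<dots> \<preceq> (\<one> \<sqdot> r) \<odot> ((\<one> \<sqdot> r) \<odot> x)" by (rule assoc2)
  also have "\<dots> \<preceq> (\<one> \<sqdot> r) \<odot> y" by (rule comp_mono_right[OF r(2)])
  also note r(3)
  finally show "le_mod s x z" using r(1) by (auto simp: le_mod_def)
next
  fix x y z assume "le_mod s z x" "le_mod s z y"
  then obtain r where "fixing s r" "(\<one> \<sqdot> r) \<odot> z \<preceq> x" "(\<one> \<sqdot> r) \<odot> z \<preceq> y"
    by (rule le_mod_common)
  then show "le_mod s z (x \<sqdot> y)" by (auto simp: le_mod_def intro: meet_greatest)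
next
  fix x x' y y' assume "le_mod s x x'" "le_mod s y y'"
  then obtain r where "fixing s r" "(\<one> \<sqdot> r) \<odot> x \<preceq> x'" "(\<one> \<sqdot> r) \<odot> y \<preceq> y'"
    by (rule le_mod_common)
  then show "le_mod s (x \<odot> y) (x' \<odot> y')"
    unfolding le_mod_def using ord_trans[OF sub_comp_dup comp_mono] by blast
qed (rule le_modI, rule ord_refl meet_lower1 meet_lower2 assoc1 assoc2 one_left1 one_left2
    one_right1 one_right2 zero_least sub_meet sub_comp_meet rotate sub_commute1 sub_commute2)+

text \<open>Syntactic substitute for being nonempty: in an integral relation algebra, a subidentity
  that fixes a nonempty relation is the identity.\<close>

definition rigid :: "trm \<Rightarrow> bool" where
  "rigid p \<longleftrightarrow> (\<forall>r. fixing p r \<longrightarrow> \<one> \<preceq> r)"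

text \<open>By \<open>sub_comp_meet\<close>, a subidentity that fixes \<open>q\<close> also fixes
  everything below \<open>q\<close>.\<close>

lemma rigid_mono:
  assumes "rigid p" "p \<preceq> q"
  shows "rigid q"
  unfolding rigid_def
proof (intro allI impI)
  fix r assume "fixing q r"
  then have "p \<preceq> (\<one> \<sqdot> r) \<odot> q" using assms(2) ord_trans by (auto simp: fixing_def)
  then have "p \<preceq> ((\<one> \<sqdot> r) \<odot> q) \<sqdot> p" by (rule meet_greatest[OF _ ord_refl])
  also have "\<dots> \<preceq> (\<one> \<sqdot> r) \<odot> (q \<sqdot> p)" by (rule sub_comp_meet)
  also have "\<dots> \<preceq> (\<one> \<sqdot> r) \<odot> p" by (rule comp_mono_right[OF meet_lower2])
  finally show "\<one> \<preceq> r" using assms(1) by (simp add: rigid_def fixing_def)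
qed

lemma rigid_comp_left:
  assumes "rigid (p \<odot> q)"
  shows "rigid p"
  unfolding rigid_def fixing_def
proof (intro allI impI)
  fix r assume "p \<preceq> (\<one> \<sqdot> r) \<odot> p"
  then have "p \<odot> q \<preceq> (\<one> \<sqdot> r) \<odot> (p \<odot> q)"
    by (rule ord_trans[OF comp_mono_left assoc2])
  then show "\<one> \<preceq> r" using assms by (simp add: rigid_def fixing_def)
qed

text \<open>What fixes the right factor fixes the product, since subidentities can be moved past the
  left factor.\<close>

lemma rigid_comp_right:
  assumes "rigid (p \<odot> q)"
  shows "rigid q"
  unfolding rigid_def fixing_def
proof (intro allI impI)
  fix r assume "q \<preceq> (\<one> \<sqdot> r) \<odot> q"
  then have "p \<odot> q \<preceq> p \<odot> ((\<one> \<sqdot> r) \<odot> q)" by (rule comp_mono_right)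
  also have "\<dots> \<preceq> (p \<odot> (\<one> \<sqdot> r)) \<odot> q" by (rule assoc1)
  also have "\<dots> \<preceq> ((\<one> \<sqdot> r) \<odot> p) \<odot> q" by (intro comp_mono_left sub_commute2)
  also have "\<dots> \<preceq> (\<one> \<sqdot> r) \<odot> (p \<odot> q)" by (rule assoc2)
  finally show "\<one> \<preceq> r" using assms by (simp add: rigid_def fixing_def)
qed

lemma rigid_one: "rigid \<one>"
  unfolding rigid_def fixing_def
  using ord_trans[OF _ ord_trans[OF one_right1 sub_le(2)]] by blast

text \<open>A term below \<open>\<one>\<close> fixes itself.\<close>

lemma rigid_sub:
  assumes "rigid p" "p \<preceq> \<one>"
  shows "\<one> \<preceq> p"
proof -
  have "p \<preceq> \<one> \<sqdot> p" by (rule meet_greatest[OF assms(2) ord_refl])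
  also have "\<dots> \<preceq> (\<one> \<sqdot> p) \<odot> (\<one> \<sqdot> p)" by (rule sub_idem)
  also have "\<dots> \<preceq> (\<one> \<sqdot> p) \<odot> p" by (rule comp_mono_right[OF sub_le(2)])
  finally show ?thesis using assms(1) by (simp add: rigid_def fixing_def)
qed

lemma one_le_rotate:
  assumes "\<one> \<preceq> x \<odot> y"
  shows "\<one> \<preceq> y \<odot> x"
  by (rule ord_trans[OF meet_greatest[OF ord_refl assms] rotate])

end

section \<open>Networks\<close>

instance trm :: countable
  by countable_datatype

text \<open>\<open>zero_consistent\<close> keeps \<open>\<zero>\<close> from being rigid, and
  \<open>comp_le_one\<close> keeps labels of edges at a new point from falling below
  \<open>\<one>\<close>.\<close>

locale rigid_term_order = term_order +
  assumes zero_consistent: "\<not> \<one> \<preceq> \<zero>"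
    and comp_le_one: "rigid (x \<odot> y) \<Longrightarrow> x \<odot> y \<preceq> \<one> \<Longrightarrow> x \<preceq> \<one> \<and> y \<preceq> \<one>"
begin

lemma not_rigid_zero: "\<not> rigid \<zero>"
  using rigid_sub zero_least zero_consistent by blast

text \<open>The set \<open>N x y\<close> consists of the terms that the pair \<open>(x, y)\<close> is to satisfy;
  the points of a network are those \<open>x\<close> for which \<open>N x x\<close> is nonempty.\<close>

definition network :: "(nat \<Rightarrow> nat \<Rightarrow> trm set) \<Rightarrow> bool" where
  "network N \<longleftrightarrow>
     (\<forall>x y p q. p \<in> N x y \<longrightarrow> p \<preceq> q \<longrightarrow> q \<in> N x y) \<and>
     (\<forall>x y p q. p \<in> N x y \<longrightarrow> q \<in> N x y \<longrightarrow> p \<sqdot> q \<in> N x y) \<and>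
     (\<forall>x y z p q. p \<in> N x y \<longrightarrow> q \<in> N y z \<longrightarrow> p \<odot> q \<in> N x z) \<and>
     (\<forall>x y p. p \<in> N x y \<longrightarrow> rigid p) \<and>
     (\<forall>x y p. p \<in> N x y \<longrightarrow> p \<preceq> \<one> \<longrightarrow> x = y) \<and>
     (\<forall>x y p. p \<in> N x y \<longrightarrow> \<one> \<in> N x x \<and> \<one> \<in> N y y) \<and>
     (\<forall>x p. p \<in> N x x \<longrightarrow> \<one> \<preceq> p)"

lemma networkD:
  assumes "network N"
  shows network_up: "p \<in> N x y \<Longrightarrow> p \<preceq> q \<Longrightarrow> q \<in> N x y"
    and network_meet: "p \<in> N x y \<Longrightarrow> q \<in> N x y \<Longrightarrow> p \<sqdot> q \<in> N x y"
    and network_comp: "p \<in> N x y \<Longrightarrow> q \<in> N y z \<Longrightarrow> p \<odot> q \<in> N x z"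
    and network_rigid: "p \<in> N x y \<Longrightarrow> rigid p"
    and network_le_one: "p \<in> N x y \<Longrightarrow> p \<preceq> \<one> \<Longrightarrow> x = y"
    and network_source: "p \<in> N x y \<Longrightarrow> \<one> \<in> N x x"
    and network_target: "p \<in> N x y \<Longrightarrow> \<one> \<in> N y y"
    and network_loop: "p \<in> N x x \<Longrightarrow> \<one> \<preceq> p"
proof -
  note n1 = assms[unfolded network_def]
  note n2 = conjunct2[OF n1]
  note n3 = conjunct2[OF n2]
  note n4 = conjunct2[OF n3]
  note n5 = conjunct2[OF n4]
  note n6 = conjunct2[OF n5]
  show "p \<in> N x y \<Longrightarrow> p \<preceq> q \<Longrightarrow> q \<in> N x y"
    by (rule conjunct1[OF n1, rule_format])
  show "p \<in> N x y \<Longrightarrow> q \<in> N x y \<Longrightarrow> p \<sqdot> q \<in> N x y"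
    by (rule conjunct1[OF n2, rule_format])
  show "p \<in> N x y \<Longrightarrow> q \<in> N y z \<Longrightarrow> p \<odot> q \<in> N x z"
    by (rule conjunct1[OF n3, rule_format])
  show "p \<in> N x y \<Longrightarrow> rigid p"
    by (rule conjunct1[OF n4, rule_format])
  show "p \<in> N x y \<Longrightarrow> p \<preceq> \<one> \<Longrightarrow> x = y"
    by (rule conjunct1[OF n5, rule_format])
  show "p \<in> N x y \<Longrightarrow> \<one> \<in> N x x" "p \<in> N x y \<Longrightarrow> \<one> \<in> N y y"
    using conjunct1[OF n6] by blast+
  show "p \<in> N x x \<Longrightarrow> \<one> \<preceq> p"
    by (rule conjunct2[OF n6, rule_format])
qed

lemma networkI:
  assumes "\<And>x y p q. p \<in> N x y \<Longrightarrow> p \<preceq> q \<Longrightarrow> q \<in> N x y"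
    and "\<And>x y p q. p \<in> N x y \<Longrightarrow> q \<in> N x y \<Longrightarrow> p \<sqdot> q \<in> N x y"
    and "\<And>x y z p q. p \<in> N x y \<Longrightarrow> q \<in> N y z \<Longrightarrow> p \<odot> q \<in> N x z"
    and "\<And>x y p. p \<in> N x y \<Longrightarrow> rigid p"
    and "\<And>x y p. p \<in> N x y \<Longrightarrow> p \<preceq> \<one> \<Longrightarrow> x = y"
    and "\<And>x y p. p \<in> N x y \<Longrightarrow> \<one> \<in> N x x \<and> \<one> \<in> N y y"
    and "\<And>x p. p \<in> N x x \<Longrightarrow> \<one> \<preceq> p"
  shows "network N"
  unfolding network_def
  by (intro conjI allI impI)
    (erule (1) assms(1,2,3,5) | erule assms(4,7) assms(6)[THEN conjunct1] assms(6)[THEN conjunct2])+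

text \<open>Adds the point \<open>n\<close> between \<open>u\<close> and \<open>v\<close> as a witness for \<open>a \<odot> b \<in> N u v\<close>.\<close>

definition extend ::
  "(nat \<Rightarrow> nat \<Rightarrow> trm set) \<Rightarrow> nat \<Rightarrow> nat \<Rightarrow> trm \<Rightarrow> trm \<Rightarrow> nat \<Rightarrow> nat \<Rightarrow> nat \<Rightarrow> trm set" where
  "extend N u v a b n x y =
     (if x = n then if y = n then {t. \<one> \<preceq> t} else {t. \<exists>p \<in> N v y. b \<odot> p \<preceq> t}
      else if y = n then {t. \<exists>p \<in> N x u. p \<odot> a \<preceq> t} else N x y)"

lemma extend_network:
  assumes N: "network N" and ab: "a \<odot> b \<in> N u v" and a: "\<not> a \<preceq> \<one>" and b: "\<not> b \<preceq> \<one>"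
  shows "network (extend N u v a b n)"
proof -
  let ?M = "extend N u v a b n"
  note up = network_up[OF N] and comp = network_comp[OF N] and rig = network_rigid[OF N]
  have ny: "?M n y = {t. \<exists>p \<in> N v y. b \<odot> p \<preceq> t}"
    and xn: "?M y n = {t. \<exists>p \<in> N y u. p \<odot> a \<preceq> t}"
    and xy: "?M x y = N x y" if "x \<noteq> n" "y \<noteq> n" for x y
    using that by (auto simp: extend_def)
  have nn: "?M n n = {t. \<one> \<preceq> t}" by (simp add: extend_def)
  \<comment> \<open>The label is a left factor of \<open>p \<odot> (a \<odot> b)\<close>, which
    belongs to the old network; dually for \<open>rig_out\<close>.\<close>
  have rig_in: "rigid (p \<odot> a)" if "p \<in> N x u" for p x
    using rig[OF up[OF comp[OF that ab] assoc1]] by (rule rigid_comp_left)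
  have rig_out: "rigid (b \<odot> p)" if "p \<in> N v x" for p x
    using rig[OF up[OF comp[OF ab that] assoc2]] by (rule rigid_comp_right)
  have cases: thesis
    if "p \<in> ?M x y"
      "\<lbrakk>x \<noteq> n; y \<noteq> n; p \<in> N x y\<rbrakk> \<Longrightarrow> thesis"
      "\<And>q. \<lbrakk>x \<noteq> n; y = n; q \<in> N x u; q \<odot> a \<preceq> p\<rbrakk> \<Longrightarrow> thesis"
      "\<And>q. \<lbrakk>x = n; y \<noteq> n; q \<in> N v y; b \<odot> q \<preceq> p\<rbrakk> \<Longrightarrow> thesis"
      "\<lbrakk>x = n; y = n; \<one> \<preceq> p\<rbrakk> \<Longrightarrow> thesis" for p x y thesis
    using that by (auto simp: extend_def split: if_splits)
  show ?thesis
  proof (rule networkI)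
    show "q \<in> ?M x y" if "p \<in> ?M x y" "p \<preceq> q" for p q x y
      using that(1)
    proof (rule cases)
      assume "x \<noteq> n" "y \<noteq> n" "p \<in> N x y"
      then show ?thesis using up[OF _ that(2)] by (simp add: xy)
    next
      fix q' assume "x \<noteq> n" "y = n" "q' \<in> N x u" "q' \<odot> a \<preceq> p"
      then show ?thesis using ord_trans[OF _ that(2)] by (auto simp: xn)
    next
      fix q' assume "x = n" "y \<noteq> n" "q' \<in> N v y" "b \<odot> q' \<preceq> p"
      then show ?thesis using ord_trans[OF _ that(2)] by (auto simp: ny)
    next
      assume "x = n" "y = n" "\<one> \<preceq> p"
      then show ?thesis using ord_trans[OF _ that(2)] by (simp add: nn)
    qed
    show "p \<sqdot> q \<in> ?M x y" if p: "p \<in> ?M x y" and q: "q \<in> ?M x y" for p q x y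
      using p
    proof (rule cases)
      assume "x \<noteq> n" "y \<noteq> n" "p \<in> N x y"
      then show ?thesis using q network_meet[OF N, of p x y q] by (simp add: xy)
    next
      fix p' assume x: "x \<noteq> n" "y = n" and p': "p' \<in> N x u" "p' \<odot> a \<preceq> p"
      then obtain q' where q': "q' \<in> N x u" "q' \<odot> a \<preceq> q" using q by (auto simp: xn)
      have "(p' \<sqdot> q') \<odot> a \<preceq> p \<sqdot> q"
        using p'(2) q'(2)
        by (meson comp_mono_left meet_greatest meet_lower1 meet_lower2 ord_trans)
      then show ?thesis using x network_meet[OF N p'(1) q'(1)] by (auto simp: xn)
    next
      fix p' assume x: "x = n" "y \<noteq> n" and p': "p' \<in> N v y" "b \<odot> p' \<preceq> p"
      then obtain q' where q': "q' \<in> N v y" "b \<odot> q' \<preceq> q" using q by (auto simp: ny)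
      have "b \<odot> (p' \<sqdot> q') \<preceq> p \<sqdot> q"
        using p'(2) q'(2)
        by (meson comp_mono_right meet_greatest meet_lower1 meet_lower2 ord_trans)
      then show ?thesis using x network_meet[OF N p'(1) q'(1)] by (auto simp: ny)
    next
      assume "x = n" "y = n" "\<one> \<preceq> p"
      then show ?thesis using q meet_greatest[of \<one> p q] by (simp add: nn)
    qed
    show "p \<odot> q \<in> ?M x z" if p: "p \<in> ?M x y" and q: "q \<in> ?M y z" for p q x y z
      using p
    proof (rule cases)
      assume xy': "x \<noteq> n" "y \<noteq> n" "p \<in> N x y"
      from q show ?thesis
      proof (rule cases)
        assume "z \<noteq> n" "q \<in> N y z"
        then show ?thesis using xy' comp[of p x y q z] by (simp add: xy)
      next
        fix q' assume "z = n" "q' \<in> N y u" "q' \<odot> a \<preceq> q"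
        moreover have "(p \<odot> q') \<odot> a \<preceq> p \<odot> q"
          by (rule ord_trans[OF assoc2 comp_mono_right]) fact
        ultimately show ?thesis using xy' comp[of p x y q' u] by (auto simp: xn)
      qed (use xy' in simp_all)
    next
      fix p' assume x: "x \<noteq> n" "y = n" and p': "p' \<in> N x u" "p' \<odot> a \<preceq> p"
      from q show ?thesis
      proof (rule cases)
        \<comment> \<open>A detour from \<open>x\<close> to \<open>z\<close> through
          \<open>n\<close> yields nothing new: it contains \<open>a \<odot> b\<close>, already a
          label from \<open>u\<close> to \<open>v\<close>.\<close>
        fix q' assume z: "z \<noteq> n" and q': "q' \<in> N v z" "b \<odot> q' \<preceq> q"
        have "(p' \<odot> (a \<odot> b)) \<odot> q' \<preceq> ((p' \<odot> a) \<odot> b) \<odot> q'" by (intro comp_mono_left assoc1)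
        also have "\<dots> \<preceq> (p' \<odot> a) \<odot> (b \<odot> q')" by (rule assoc2)
        also have "\<dots> \<preceq> p \<odot> q" by (rule comp_mono[OF p'(2) q'(2)])
        finally show ?thesis
          using up[OF comp[OF comp[OF p'(1) ab] q'(1)]] x z by (simp add: xy)
      next
        assume z: "z = n" and "\<one> \<preceq> q"
        then have "p' \<odot> a \<preceq> p \<odot> q"
          using p'(2) by (blast intro: ord_trans[OF one_right2 comp_mono])
        then show ?thesis using x z p'(1) by (auto simp: xn)
      qed (use x in simp_all)
    next
      fix p' assume x: "x = n" "y \<noteq> n" and p': "p' \<in> N v y" "b \<odot> p' \<preceq> p"
      from q show ?thesis
      proof (rule cases)
        assume z: "z \<noteq> n" and "q \<in> N y z"
        moreover have "b \<odot> (p' \<odot> q) \<preceq> p \<odot> q"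
          by (rule ord_trans[OF assoc1 comp_mono_left[OF p'(2)]])
        ultimately show ?thesis using x comp[OF p'(1), of q z] by (auto simp: ny)
      next
        \<comment> \<open>The cycle from \<open>n\<close> through \<open>v\<close>, \<open>y\<close>
          and \<open>u\<close> back to \<open>n\<close> is read from \<open>u\<close> first, where
          it is an old loop and so lies above \<open>\<one>\<close>; then it is rotated.\<close>
        fix q' assume z: "z = n" and q': "q' \<in> N y u" "q' \<odot> a \<preceq> q"
        have "\<one> \<preceq> (a \<odot> b) \<odot> (p' \<odot> q')"
          by (rule network_loop[OF N comp[OF ab comp[OF p'(1) q'(1)]]])
        also have "\<dots> \<preceq> a \<odot> (b \<odot> (p' \<odot> q'))" by (rule assoc2)
        finally have "\<one> \<preceq> (b \<odot> (p' \<odot> q')) \<odot> a" by (rule one_le_rotate)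
        also have "\<dots> \<preceq> ((b \<odot> p') \<odot> q') \<odot> a" by (intro comp_mono_left assoc1)
        also have "\<dots> \<preceq> (b \<odot> p') \<odot> (q' \<odot> a)" by (rule assoc2)
        also have "\<dots> \<preceq> p \<odot> q" by (rule comp_mono[OF p'(2) q'(2)])
        finally show ?thesis using x z by (simp add: nn)
      qed (use x in simp_all)
    next
      assume x: "x = n" "y = n" "\<one> \<preceq> p"
      from q show ?thesis
      proof (rule cases)
        fix q' assume z: "z \<noteq> n" and q': "q' \<in> N v z" "b \<odot> q' \<preceq> q"
        then have "b \<odot> q' \<preceq> p \<odot> q"
          using x(3) by (blast intro: ord_trans[OF one_left2 comp_mono])
        then show ?thesis using x z q'(1) by (auto simp: ny)
      next
        assume "z = n" "\<one> \<preceq> q"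
        then have "\<one> \<preceq> p \<odot> q" using x(3) by (blast intro: ord_trans[OF one_left2 comp_mono])
        then show ?thesis using x(1) \<open>z = n\<close> by (simp add: nn)
      qed (use x in simp_all)
    qed
    show "rigid p" if "p \<in> ?M x y" for p x y
      using that
      by (rule cases)
        (erule rig rigid_mono[OF rig_in] rigid_mono[OF rig_out] rigid_mono[OF rigid_one]; assumption)+
    \<comment> \<open>A label below \<open>\<one>\<close> between \<open>n\<close> and an old point
      would force \<open>a\<close> or \<open>b\<close> below \<open>\<one>\<close> by
      \<open>comp_le_one\<close>.\<close>
    show "x = y" if "p \<in> ?M x y" "p \<preceq> \<one>" for p x y
      using that(1)
    proof (rule cases)
      fix q assume "q \<in> N x u" "q \<odot> a \<preceq> p"
      then show ?thesis using comp_le_one[OF rig_in] ord_trans[OF _ that(2)] a by blast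
    next
      fix q assume "q \<in> N v y" "b \<odot> q \<preceq> p"
      then show ?thesis using comp_le_one[OF rig_out] ord_trans[OF _ that(2)] b by blast
    qed (use network_le_one[OF N _ that(2)] in simp_all)
    show "\<one> \<in> ?M x x \<and> \<one> \<in> ?M y y" if "p \<in> ?M x y" for p x y
      using that
      by (rule cases) (auto simp: nn xy ord_refl intro: network_source[OF N] network_target[OF N])
    show "\<one> \<preceq> p" if "p \<in> ?M x x" for p x
      using that by (rule cases) (simp_all add: network_loop[OF N])
  qed
qed

text \<open>If \<open>s \<preceq> \<one>\<close>, rigidity gives \<open>\<one> \<preceq> s\<close>
  and a single loop suffices; otherwise an edge from 0 to 1 is needed.\<close>

lemma initial_network:
  assumes s: "rigid s"
  obtains N y where "network N" "y < 2" "N 0 y = {t. s \<preceq> t}"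
proof (cases "s \<preceq> \<one>")
  case True
  define N where "N x y = (if x = 0 \<and> y = 0 then {t. \<one> \<preceq> t} else {})" for x y :: nat
  have "network N"
  proof (rule networkI)
    show "p \<odot> q \<in> N x z" if "p \<in> N x y" "q \<in> N y z" for x y z p q
      using that by (auto simp: N_def intro: ord_trans[OF one_left2 comp_mono] split: if_splits)
  qed (auto simp: N_def intro: ord_trans meet_greatest rigid_mono[OF rigid_one] ord_refl
      split: if_splits)
  moreover have "N 0 0 = {t. s \<preceq> t}"
    using True rigid_sub[OF s True] by (auto simp: N_def intro: ord_trans)
  ultimately show ?thesis
    by (intro that[of N 0]) simp_all
next
  case False
  define N where "N x y = (if x = y \<and> x < 2 then {t. \<one> \<preceq> t}
      else if x = 0 \<and> y = 1 then {t. s \<preceq> t} else {})" for x y :: nat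
  have "network N"
  proof (rule networkI)
    show "p \<odot> q \<in> N x z" if "p \<in> N x y" "q \<in> N y z" for x y z p q
      using that
      by (auto simp: N_def split: if_splits
          intro: ord_trans[OF one_left2 comp_mono] ord_trans[OF one_right2 comp_mono])
    show "x = y" if "p \<in> N x y" "p \<preceq> \<one>" for x y p
      using that False ord_trans[of s p \<one>] by (auto simp: N_def split: if_splits)
  qed (auto simp: N_def intro: ord_trans meet_greatest rigid_mono[OF rigid_one] rigid_mono[OF s] ord_refl
      split: if_splits)
  then show ?thesis
    by (intro that[of N 1]) (simp_all add: N_def)
qed

text \<open>All possible demands for a witness are enumerated and met one by one; the limit of the
  stages is \<open>L\<close>.\<close>

lemma saturated_network:
  assumes "rigid s"
  obtains L y where "network L" "L 0 y = {t. s \<preceq> t}"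
    "\<forall>x y p q. p \<odot> q \<in> L x y \<longrightarrow> (\<exists>z. p \<in> L x z \<and> q \<in> L z y)"
proof -
  obtain N0 y0 where N0: "network N0" "y0 < 2"
    "N0 0 y0 = {t. s \<preceq> t}"
    using initial_network[OF assms] by blast
  define task :: "nat \<Rightarrow> nat \<times> nat \<times> trm \<times> trm" where
    "task k = (let (x, j) = prod_decode k; (y, i) = prod_decode j in (x, y, from_nat i))" for k
  \<comment> \<open>Step \<open>k\<close> can add only the point \<open>k + 2\<close>, as 0 and 1
    are reserved for the initial network. A factor below \<open>\<one>\<close> needs no new point: a
    loop will be its witness.\<close>
  define step where "step k N =
      (case task k of (u, v, a, b) \<Rightarrow>
        if a \<odot> b \<in> N u v \<and> \<not> a \<preceq> \<one> \<and> \<not> b \<preceq> \<one> then extend N u v a b (k + 2) else N)" for k N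
  define stage where "stage k = rec_nat N0 step k" for k
  have stage_0: "stage 0 = N0" and stage_Suc: "stage (Suc k) = step k (stage k)" for k
    by (simp_all add: stage_def)
  have net: "network (stage k)" for k
    by (induction k) (auto simp: stage_0 stage_Suc step_def N0(1) intro: extend_network split: prod.split)
  have stable: "stage (k + j) x y = stage k x y" if "x < k + 2" "y < k + 2" for j k x y
  proof (induction j)
    case (Suc j)
    then show ?case
      using that by (auto simp: stage_Suc step_def extend_def split: prod.split)
  qed simp
  \<comment> \<open>By \<open>stable\<close> this entry no longer changes after stage
    \<open>max x y\<close>, so each network condition, involving at most three points, can be
    checked at one stage.\<close>
  define L where "L x y = stage (max x y) x y" for x y
  have L: "L x y = stage k x y" if "x \<le> k" "y \<le> k" for x y k
    using stable[of x "max x y" y "k - max x y"] that by (simp add: L_def)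
  have L3: "L x y = stage (x + y + z) x y" "L y z = stage (x + y + z) y z"
    "L x z = stage (x + y + z) x z" "L x x = stage (x + y + z) x x" "L y y = stage (x + y + z) y y" for x y z
    by (rule L; simp)+
  have "network L"
  proof (rule networkI)
    fix x y z :: nat and p q
    let ?k = "x + y + z"
    note N = net[of ?k]
    show "q \<in> L x y" if "p \<in> L x y" "p \<preceq> q"
      using that network_up[OF N] unfolding L3(1)[where x = x and y = y and z = z] by blast
    show "p \<sqdot> q \<in> L x y" if "p \<in> L x y" "q \<in> L x y"
      using that network_meet[OF N] unfolding L3(1)[where x = x and y = y and z = z] by blast
    show "p \<odot> q \<in> L x z" if "p \<in> L x y" "q \<in> L y z"
      using that network_comp[OF N] unfolding L3(1,2,3)[where x = x and y = y and z = z] by blast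
    show "rigid p" if "p \<in> L x y"
      using that network_rigid[OF N] unfolding L3(1)[where x = x and y = y and z = z] by blast
    show "x = y" if "p \<in> L x y" "p \<preceq> \<one>"
      using that network_le_one[OF N] unfolding L3(1)[where x = x and y = y and z = z] by blast
    show "\<one> \<in> L x x \<and> \<one> \<in> L y y" if "p \<in> L x y"
      using that network_source[OF N] network_target[OF N]
      unfolding L3(1,4,5)[where x = x and y = y and z = z] by blast
    show "\<one> \<preceq> p" if "p \<in> L x x"
      using that network_loop[OF N] unfolding L3(4)[where x = x and y = y and z = z] by blast
  qed
  moreover have "L 0 y0 = {t. s \<preceq> t}"
    using stable[of 0 0 y0 y0] N0(2,3) by (simp add: L_def stage_0)
  moreover have "\<exists>z. p \<in> L x z \<and> q \<in> L z y" if pq: "p \<odot> q \<in> L x y" for x y p q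
  proof -
    note up = network_up[OF \<open>network L\<close>]
    have rig: "rigid (p \<odot> q)" by (rule network_rigid[OF \<open>network L\<close> pq])
    consider "p \<preceq> \<one>" | "q \<preceq> \<one>" | "\<not> p \<preceq> \<one>" "\<not> q \<preceq> \<one>" by blast
    then show ?thesis
    proof cases
      case 1
      \<comment> \<open>Being rigid and below \<open>\<one>\<close>, \<open>p\<close> is also above
        \<open>\<one>\<close>, so \<open>x\<close> itself is the witness.\<close>
      have "p \<in> L x x"
        by (rule up[OF network_source[OF \<open>network L\<close> pq] rigid_sub[OF rigid_comp_left[OF rig] 1]])
      moreover have "q \<in> L x y"
        by (rule up[OF pq ord_trans[OF comp_mono_left[OF 1] one_left1]])
      ultimately show ?thesis by blast
    next
      case 2
      have "q \<in> L y y"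
        by (rule up[OF network_target[OF \<open>network L\<close> pq] rigid_sub[OF rigid_comp_right[OF rig] 2]])
      moreover have "p \<in> L x y"
        by (rule up[OF pq ord_trans[OF comp_mono_right[OF 2] one_right1]])
      ultimately show ?thesis by blast
    next
      case 3
      \<comment> \<open>The code of a task is at least as large as its two points, so their label is
        already final at stage \<open>k\<close>.\<close>
      define k where "k = prod_encode (x, prod_encode (y, to_nat (p, q)))"
      have task: "task k = (x, y, p, q)" by (simp add: task_def k_def)
      have xk: "x \<le> k" "y \<le> k"
        unfolding k_def using le_prod_encode_1 le_prod_encode_2 order_trans by blast+
      then have mem: "p \<odot> q \<in> stage k x y" using pq L by simp
      have "stage (Suc k) = extend (stage k) x y p q (k + 2)"
        using mem 3 by (simp add: stage_Suc step_def task)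
      \<comment> \<open>Composing with these loops makes \<open>p\<close> and \<open>q\<close>
        themselves labels at the new point.\<close>
      moreover have "\<one> \<in> stage k x x" "\<one> \<in> stage k y y"
        using network_source[OF net mem] network_target[OF net mem] by blast+
      ultimately have "p \<in> stage (Suc k) x (k + 2)" "q \<in> stage (Suc k) (k + 2) y"
        using xk one_left1 one_right1 by (auto simp: extend_def)
      moreover have "L x (k + 2) = stage (Suc k) x (k + 2)" "L (k + 2) y = stage (Suc k) (k + 2) y"
        using stable[of x "Suc k" "k + 2" 1] stable[of "k + 2" "Suc k" y 1] L[of _ "k + 2"] xk
        by simp_all
      ultimately show ?thesis by blast
    qed
  qed
  ultimately show ?thesis using that by blast
qed

text \<open>The points of a saturated network are embedded into \<open>'u\<close>, and each term
  denotes the set of edges it labels.\<close>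

theorem integral_representation:
  assumes "rigid s" "infinite (UNIV :: 'u set)"
  obtains \<AA> :: "('u \<times> 'u) set alg" and v x y
  where "\<AA> \<in> Rel_i" "range v \<subseteq> carrier \<AA>" "\<forall>t. (x, y) \<in> eval \<AA> v t \<longleftrightarrow> s \<preceq> t"
proof -
  obtain L y0 where L: "network L" "L 0 y0 = {t. s \<preceq> t}"
    and wit: "\<forall>x y p q. p \<odot> q \<in> L x y \<longrightarrow> (\<exists>z. p \<in> L x z \<and> q \<in> L z y)"
    using saturated_network[OF assms(1)] by blast
  obtain f :: "nat \<Rightarrow> 'u" where f: "inj f"
    using assms(2) infinite_countable_subset by blast
  note f_eq = inj_eq[OF f]
  define rep where "rep t = {(f x, f y) | x y. t \<in> L x y}" for t
  have rep_iff: "(f x, f y) \<in> rep t \<longleftrightarrow> t \<in> L x y" for x y t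
    by (auto simp: rep_def f_eq)
  define U where "U = f ` {x. \<one> \<in> L x x}"
  have meet: "rep (a \<sqdot> b) = rep a \<inter> rep b" for a b
  proof -
    have "a \<sqdot> b \<in> L x y \<longleftrightarrow> a \<in> L x y \<and> b \<in> L x y" for x y
      by (metis network_meet[OF L(1)] network_up[OF L(1)] meet_lower1 meet_lower2)
    then show ?thesis by (auto simp: rep_def f_eq)
  qed
  have comp: "rep (a \<odot> b) = rep a O rep b" for a b
  proof
    show "rep (a \<odot> b) \<subseteq> rep a O rep b"
    proof
      fix e assume "e \<in> rep (a \<odot> b)"
      then obtain x y where "e = (f x, f y)" "a \<odot> b \<in> L x y" by (auto simp: rep_def)
      moreover then obtain z where "a \<in> L x z" "b \<in> L z y" using wit by blast
      ultimately show "e \<in> rep a O rep b" using rep_iff by blast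
    qed
    show "rep a O rep b \<subseteq> rep (a \<odot> b)"
      by (auto simp: rep_def f_eq intro: network_comp[OF L(1)])
  qed
  have zero: "rep \<zero> = {}"
    using network_rigid[OF L(1)] not_rigid_zero unfolding rep_def by blast
  have one: "rep \<one> = Id_on U"
  proof -
    have "\<one> \<in> L x y \<Longrightarrow> x = y" for x y using network_le_one[OF L(1)] ord_refl by blast
    then show ?thesis unfolding rep_def U_def by auto
  qed
  have sub: "rep a \<subseteq> U \<times> U" for a
    unfolding rep_def U_def using network_source[OF L(1)] network_target[OF L(1)] by blast
  define \<AA> where "\<AA> = \<lparr>carrier = range rep, meet = (\<inter>), comp = (O), zero = {}, one = Id_on U\<rparr>"
  have alg: "is_alg \<AA>"
    unfolding is_alg_def \<AA>_def using meet comp zero one by (auto simp: image_iff; metis)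
  have "relation_algebra \<AA>"
    unfolding relation_algebra_def using alg sub by (intro conjI exI[of _ U]) (auto simp: \<AA>_def)
  moreover have "integral \<AA>"
  proof -
    have "\<one> \<in> L 0 0"
      using network_source[OF L(1), of s 0 y0] L(2) ord_refl by simp
    then have "Id_on U \<noteq> {}" by (auto simp: U_def)
    \<comment> \<open>A single loop labelled \<open>a\<close> gives
      \<open>\<one> \<preceq> a\<close>, and then \<open>a\<close> labels all loops.\<close>
    moreover have "rep a = Id_on U" if a: "rep a \<noteq> {}" "rep a \<inter> Id_on U = rep a" for a
    proof -
      obtain x y where xy: "a \<in> L x y" using a(1) by (auto simp: rep_def)
      then have "(f x, f y) \<in> Id_on U" using a(2) rep_iff by blast
      then have "x = y" by (auto simp: f_eq)
      then have "\<one> \<preceq> a" using xy network_loop[OF L(1)] by blast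
      then have "rep \<one> \<subseteq> rep a" unfolding rep_def using network_up[OF L(1)] by blast
      then show ?thesis using a(2) one by blast
    qed
    ultimately show ?thesis by (auto simp: integral_def \<AA>_def)
  qed
  ultimately have "\<AA> \<in> Rel_i" by (simp add: Rel_i_def)
  moreover have ev: "eval \<AA> (\<lambda>n. rep (Var n)) t = rep t" for t
    by (induction t) (simp_all add: \<AA>_def meet comp zero one)
  moreover have "(f 0, f y0) \<in> rep t \<longleftrightarrow> s \<preceq> t" for t
    by (simp add: rep_iff L(2))
  ultimately show ?thesis
    by (intro that[of \<AA> "\<lambda>n. rep (Var n)" "f 0" "f y0"]) (auto simp: \<AA>_def)
qed

end

section \<open>Completeness\<close>

context term_order
begin

text \<open>If \<open>r\<close> fixes \<open>s\<close>, then \<open>s\<close> lies below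
  \<open>(\<one> \<sqdot> r) \<odot> s\<close>. So the identifications prove nothing new about what
  is above \<open>s\<close>.\<close>

lemma le_mod_self_iff: "le_mod s s t \<longleftrightarrow> s \<preceq> t"
  using ord_trans le_modI unfolding le_mod_def fixing_def by blast

text \<open>By \<open>le_mod_self_iff\<close>, what fixes \<open>s\<close> modulo \<open>s\<close>
  fixes it already in \<open>\<preceq>\<close>, and was therefore identified with
  \<open>\<one>\<close>.\<close>

lemma rigid_le_mod: "term_order.rigid (le_mod s) s"
proof -
  interpret m: term_order "le_mod s" by (rule term_order_le_mod)
  show ?thesis
    unfolding m.rigid_def m.fixing_def
  proof (intro allI impI)
    fix r assume "le_mod s s ((\<one> \<sqdot> r) \<odot> s)"
    then have "fixing s r" by (simp add: le_mod_self_iff fixing_def)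
    moreover have "(\<one> \<sqdot> r) \<odot> \<one> \<preceq> r" by (rule ord_trans[OF one_right1 sub_le(2)])
    ultimately show "le_mod s \<one> r" by (auto simp: le_mod_def)
  qed
qed

end

text \<open>Inconsistency would give \<open>s\<close> below \<open>\<zero> \<odot> s\<close>, hence
  below \<open>t\<close>. For \<open>comp_le_one\<close>, the inequality modulo \<open>s\<close>
  unfolds to a provable one, which is evaluated in \<open>chain_alg\<close>.\<close>

lemma rigid_term_order_prov:
  assumes "\<not> prov_le s t"
  shows "rigid_term_order (term_order.le_mod prov_le s)"
proof -
  interpret p: term_order prov_le by (rule term_order_prov_le)
  interpret m: term_order "p.le_mod s" by (rule p.term_order_le_mod)
  have zero_comp: "prov_le (\<zero> \<odot> x) y" for x y
    by (rule p.ord_trans[OF prov_leI[OF derivable.sym[OF Ax_i_instances(9)]] p.zero_least])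
  have consistent: "\<not> p.le_mod s \<one> \<zero>"
  proof
    assume "p.le_mod s \<one> \<zero>"
    then have "p.le_mod s s (\<zero> \<odot> s)"
      by (rule m.ord_trans[OF m.one_left2 m.comp_mono_left])
    then have "prov_le s (\<zero> \<odot> s)" by (simp add: p.le_mod_self_iff)
    then show False using assms p.ord_trans[OF _ zero_comp] by blast
  qed
  show ?thesis
  proof
    show "\<not> p.le_mod s \<one> \<zero>" by (rule consistent)
    fix x y assume rig: "m.rigid (x \<odot> y)" and le: "p.le_mod s (x \<odot> y) \<one>"
    then obtain r where r: "p.fixing s r" and d: "prov_le ((\<one> \<sqdot> r) \<odot> (x \<odot> y)) \<one>"
      by (auto simp: p.le_mod_def)
    let ?v = "eval chain_alg (\<lambda>_. 2)"
    have "satisfies chain_alg ((\<one> \<sqdot> r) \<odot> (x \<odot> y) \<sqdot> \<one>, (\<one> \<sqdot> r) \<odot> (x \<odot> y))"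
      by (rule derivable_sound[OF d chain_alg_model])
    then have "?v ((\<one> \<sqdot> r) \<odot> (x \<odot> y) \<sqdot> \<one>) = ?v ((\<one> \<sqdot> r) \<odot> (x \<odot> y))"
      by (simp add: satisfies_def chain_alg_def)
    moreover have "?v r \<noteq> 0"
    proof
      assume "?v r = 0"
      then have "prov_le (\<one> \<sqdot> r) \<zero>"
        by (rule p.ord_trans[OF p.sub_le(2) chain_alg_eval(1)])
      then have "prov_le s (\<zero> \<odot> s)"
        using r unfolding p.fixing_def by (blast intro: p.ord_trans p.comp_mono_left)
      then show False using assms p.ord_trans[OF _ zero_comp] by blast
    qed
    \<comment> \<open>Otherwise \<open>\<one>\<close> would lie below \<open>x \<odot> y\<close> by
      \<open>rigid_sub\<close>, and so below \<open>\<zero>\<close>.\<close>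
    moreover have "?v (x \<odot> y) \<noteq> 0"
    proof
      assume "?v (x \<odot> y) = 0"
      then have "p.le_mod s (x \<odot> y) \<zero>" by (rule p.le_modI[OF chain_alg_eval(1)])
      then show False
        using consistent m.rigid_sub[OF rig le] m.ord_trans by blast
    qed
    ultimately have "?v x = 1" "?v y = 1"
      by (auto simp: chain_alg_def min_def max_def split: if_splits)
    then show "p.le_mod s x \<one> \<and> p.le_mod s y \<one>"
      using p.le_modI chain_alg_eval(2) by blast
  qed
qed

lemma valid_imp_prov_le:
  assumes "infinite (UNIV :: 'u set)"
    and valid: "\<forall>\<AA> \<in> (Rel_i :: ('u \<times> 'u) set alg set). satisfies \<AA> (s, t)"
  shows "prov_le s t"
proof (rule ccontr)
  assume n: "\<not> prov_le s t"
  interpret p: term_order prov_le by (rule term_order_prov_le)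
  interpret m: rigid_term_order "p.le_mod s" by (rule rigid_term_order_prov[OF n])
  obtain \<AA> :: "('u \<times> 'u) set alg" and v x y
    where A: "\<AA> \<in> Rel_i" "range v \<subseteq> carrier \<AA>"
      and ev: "\<forall>t. (x, y) \<in> eval \<AA> v t \<longleftrightarrow> p.le_mod s s t"
    using m.integral_representation[OF p.rigid_le_mod assms(1)] by blast
  have "eval \<AA> v s = eval \<AA> v t"
    using valid A by (auto simp: satisfies_def)
  then have "p.le_mod s s t" using ev m.ord_refl by blast
  then show False using n by (simp add: p.le_mod_self_iff)
qed

theorem theorem2p1:
  assumes "infinite (UNIV :: 'u set)"
  shows "(variety_generated (Rel_i :: ('u \<times> 'u) set alg set) :: 'a alg set) = models Ax_i \<and>
    (\<forall>s t. (\<forall>\<AA> \<in> (Rel_i :: ('u \<times> 'u) set alg set). satisfies \<AA> (s, t))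
             \<longleftrightarrow> derivable Ax_i s t)"
proof -
  let ?K = "Rel_i :: ('u \<times> 'u) set alg set"
  have sound: "satisfies \<AA> (s, t)" if "derivable Ax_i s t" "\<AA> \<in> ?K" for s t \<AA>
    using derivable_sound[OF that(1)] that(2) Rel_i_sound by blast
  have complete: "derivable Ax_i s t" if valid: "\<forall>\<AA> \<in> ?K. satisfies \<AA> (s, t)" for s t
  proof -
    have "\<forall>\<AA> \<in> ?K. satisfies \<AA> (t, s)" using valid by (simp add: satisfies_def)
    then show ?thesis
      using valid valid_imp_prov_le[OF assms] prov_le_antisym by blast
  qed
  \<comment> \<open>Every equation in \<open>E\<close> holds throughout \<open>?K\<close>, so it is
    derivable from \<open>Ax_i\<close> by completeness and passes to all models of
    \<open>Ax_i\<close>, on whatever type.\<close>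
  have "models Ax_i \<subseteq> (models E :: 'a alg set)" if "?K \<subseteq> models E" for E
  proof
    fix \<BB> :: "'a alg" assume B: "\<BB> \<in> models Ax_i"
    have "satisfies \<BB> e" if "e \<in> E" for e
    proof -
      have "\<forall>\<AA> \<in> ?K. satisfies \<AA> e"
        using \<open>?K \<subseteq> models E\<close> that by (auto simp: models_def)
      then show ?thesis
        using complete derivable_sound[OF _ B] by (cases e) blast
    qed
    then show "\<BB> \<in> models E" using B by (simp add: models_def)
  qed
  then have "(variety_generated ?K :: 'a alg set) = models Ax_i"
    using Rel_i_sound unfolding variety_generated_def by blast
  then show ?thesis using sound complete by blast
qed

end
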